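(* Let $\sigma(m)=\sum_{d\mid m}d$ be the sum of divisors function, and let $(\varphi_n(x))_{n=1}^\infty$ be the sequence of polynomials in $\mathbb{Q}[x]$ defined by $$\sum_{h=0}^{\infty}\varphi_{h+1}(x)t^h=\prod_{k=1}^{\infty}\frac{1}{(1-t^k)^x}.$$ Then for all $n\ge1$: (1) $\displaystyle \varphi_{n+1}(x)=\frac{1}{n!}\sum_{h=1}^{n}B_{n,h}\bigl(0!\,\sigma(1),1!\,\sigma(2),\ldots,(n-h)!\,\sigma(n-h+1)\bigr)x^h$; (2) $\displaystyle \varphi_{n+1}(x)=\sum_{h=1}^{n}\frac{1}{h!}B_{n,h}^{0}\Bigl(\sigma(1),\frac{\sigma(2)}{2},\ldots,\frac{\sigma(n-h+1)}{n-h+1}\Bigr)x^h$; and, moreover, as formal power series in $t$ over $\mathbb{Q}[x]$, (3) $\displaystyle \sum_{h=0}^{\infty}\varphi_{h+1}(x)t^h=\exp\Bigl(x\sum_{k=1}^{\infty}\frac{\sigma(k)}{k}t^k\Bigr)$.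
   Context: Here $(1-t^k)^{-x}=\sum_{i\ge0}(-1)^i\binom{-x}{i}t^{ki}\in\mathbb{Q}[x][[t]]$, with $\binom{y}{i}=\frac{y(y-1)\cdots(y-i+1)}{i!}$. For example $\varphi_1=1$, $\varphi_2=x$, $\varphi_3=\frac12x(x+3)$. $B_{n,h}$ denotes the partial (exponential) Bell polynomials, $$B_{n,h}(x_1,\ldots,x_{n-h+1})=\sum\frac{n!}{i_1!\,i_2!\cdots}\prod_{j}\Bigl(\frac{x_j}{j!}\Bigr)^{i_j},$$ and $B_{n,h}^0$ the partial ordinary Bell polynomials, $$B^0_{n,h}(x_1,\ldots,x_{n-h+1})=h!\sum\prod_j\frac{x_j^{i_j}}{i_j!},$$ both sums being over nonnegative integers $i_1,i_2,\ldots$ with $\sum_j j\,i_j=n$ and $\sum_j i_j=h$. Equivalently $\bigl(\sum_{m\ge1}x_mz^m\bigr)^h=\sum_{n\ge h}B^0_{n,h}(x_1,\ldots,x_{n-h+1})z^n$. *)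

theory Defs
  imports "HOL-Analysis.Analysis"
begin

definition divisor_sum :: "nat \<Rightarrow> nat" where
  "divisor_sum m = (\<Sum>d | d dvd m. d)"

text \<open>
  Exponent families \<open>i\<^sub>1, i\<^sub>2, \<dots>\<close> with \<open>\<Sum>\<^sub>j j i\<^sub>j = n\<close> and \<open>\<Sum>\<^sub>j i\<^sub>j = h\<close>. These equations force
  \<open>i\<^sub>j = 0\<close> for \<open>j > n - h + 1\<close> (see \<open>bell_index_eq\<close> below), so that the families are represented
  by functions supported on \<open>{1..n - h + 1}\<close>.
\<close>

definition bell_index :: "nat \<Rightarrow> nat \<Rightarrow> (nat \<Rightarrow> nat) set" where
  "bell_index n h =
     {i. (\<forall>j. j \<notin> {1..n - h + 1} \<longrightarrow> i j = 0) \<and>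
         (\<Sum>j=1..n - h + 1. j * i j) = n \<and> (\<Sum>j=1..n - h + 1. i j) = h}"

text \<open>
  The arguments \<open>x\<^sub>1, \<dots>, x\<^sub>n\<^sub>-\<^sub>h\<^sub>+\<^sub>1\<close> of the Bell polynomials are the values of \<open>x :: nat \<Rightarrow> 'a\<close> on
  \<open>{1..n - h + 1}\<close>.
\<close>

definition bell_exp :: "nat \<Rightarrow> nat \<Rightarrow> (nat \<Rightarrow> 'a::field_char_0) \<Rightarrow> 'a" where
  "bell_exp n h x =
     (\<Sum>i\<in>bell_index n h.
        fact n / (\<Prod>j=1..n - h + 1. fact (i j)) * (\<Prod>j=1..n - h + 1. (x j / fact j) ^ i j))"

definition bell_ord :: "nat \<Rightarrow> nat \<Rightarrow> (nat \<Rightarrow> 'a::field_char_0) \<Rightarrow> 'a" where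
  "bell_ord n h x =
     fact h * (\<Sum>i\<in>bell_index n h. \<Prod>j=1..n - h + 1. x j ^ i j / fact (i j))"

text \<open>
  Generalised binomial coefficients in \<open>\<rat>[x]\<close>; the library's \<open>gchoose\<close> is constrained to fields.
\<close>

definition binom_poly :: "rat poly \<Rightarrow> nat \<Rightarrow> rat poly" where
  "binom_poly y i = smult (1 / fact i) (\<Prod>j<i. y - of_nat j)"

text \<open>
  \<open>(1 - t\<^sup>k)\<^sup>-\<^sup>x\<close> for \<open>k \<ge> 1\<close>; the variable \<open>x\<close> of \<open>\<rat>[x]\<close> is \<open>[:0, 1:] :: rat poly\<close>, and \<open>t\<close> is
  \<open>fps_X\<close>.
\<close>

definition one_minus_pow_neg_x :: "nat \<Rightarrow> rat poly fps" where
  "one_minus_pow_neg_x k =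
     Abs_fps (\<lambda>i. (-1) ^ i * binom_poly (- [:0, 1:]) i) oo fps_X ^ k"

text \<open>
  The formal exponential \<open>\<Sum>\<^sub>i G\<^sup>i / i!\<close> for \<open>G\<close> with zero constant term. The library's \<open>fps_exp\<close>
  requires coefficients in a field, which \<open>\<rat>[x]\<close> is not.
\<close>

definition exp_fps :: "rat poly fps \<Rightarrow> rat poly fps" where
  "exp_fps G = Abs_fps (\<lambda>i. [:1 / fact i:]) oo G"

lemma bell_index_eq:
  "bell_index n h =
     {i. i 0 = 0 \<and> finite {j. i j \<noteq> 0} \<and> (\<Sum>j | i j \<noteq> 0. j * i j) = n \<and> (\<Sum>j | i j \<noteq> 0. i j) = h}"
proof -
  have *: "{j. i j \<noteq> 0} \<subseteq> {1..n - h + 1}"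
    if "i 0 = 0" "finite {j. i j \<noteq> 0}" "(\<Sum>j | i j \<noteq> 0. j * i j) = n" "(\<Sum>j | i j \<noteq> 0. i j) = h"
    for i :: "nat \<Rightarrow> nat"
  proof
    fix j assume j: "j \<in> {j. i j \<noteq> 0}"
    have pos: "l \<ge> 1" if "l \<in> {j. i j \<noteq> 0}" for l
      using that \<open>i 0 = 0\<close> by (cases l) auto
    have "n = h + (\<Sum>l | i l \<noteq> 0. (l - 1) * i l)"
      unfolding that(3,4)[symmetric] sum.distrib[symmetric]
    proof (rule sum.cong)
      fix l assume "l \<in> {j. i j \<noteq> 0}"
      then show "l * i l = i l + (l - 1) * i l"
        using pos[of l] by (cases l) auto
    qed auto
    moreover have "(j - 1) * i j \<le> (\<Sum>l | i l \<noteq> 0. (l - 1) * i l)"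
      by (rule member_le_sum[of j "{j. i j \<noteq> 0}" "\<lambda>l. (l - 1) * i l"]) (use j that in auto)
    moreover have "j - 1 \<le> (j - 1) * i j"
      using j by simp
    ultimately have "j \<le> n - h + 1"
      by linarith
    then show "j \<in> {1..n - h + 1}"
      using pos[OF j] by simp
  qed
  have sums: "(\<Sum>j | i j \<noteq> 0. f j * i j) = (\<Sum>j=1..n - h + 1. f j * i j)"
    if "{j. i j \<noteq> 0} \<subseteq> {1..n - h + 1}" for i f :: "nat \<Rightarrow> nat"
    using that by (intro sum.mono_neutral_left) auto
  have supp: "(\<forall>j. j \<notin> {1..n - h + 1} \<longrightarrow> i j = 0) \<longleftrightarrow> {j. i j \<noteq> 0} \<subseteq> {1..n - h + 1}"
    for i :: "nat \<Rightarrow> nat"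
    by auto
  show ?thesis
  proof (intro set_eqI iffI)
    fix i assume "i \<in> bell_index n h"
    then have i: "{j. i j \<noteq> 0} \<subseteq> {1..n - h + 1}" "(\<Sum>j=1..n - h + 1. j * i j) = n"
      "(\<Sum>j=1..n - h + 1. i j) = h"
      unfolding bell_index_def supp by auto
    then have "i 0 = 0"
      by (metis (mono_tags) atLeastAtMost_iff mem_Collect_eq not_one_le_zero subsetD)
    moreover have "finite {j. i j \<noteq> 0}"
      using i(1) finite_subset by blast
    ultimately show "i \<in> {i. i 0 = 0 \<and> finite {j. i j \<noteq> 0} \<and> (\<Sum>j | i j \<noteq> 0. j * i j) = n \<and>
        (\<Sum>j | i j \<noteq> 0. i j) = h}"
      using sums[OF i(1), of "\<lambda>j. j"] sums[OF i(1), of "\<lambda>j. 1"] i by simp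
  next
    fix i assume "i \<in> {i. i 0 = 0 \<and> finite {j. i j \<noteq> 0} \<and> (\<Sum>j | i j \<noteq> 0. j * i j) = n \<and>
        (\<Sum>j | i j \<noteq> 0. i j) = h}"
    then have i: "i 0 = 0" "finite {j. i j \<noteq> 0}" "(\<Sum>j | i j \<noteq> 0. j * i j) = n"
      "(\<Sum>j | i j \<noteq> 0. i j) = h"
      by auto
    note s = *[OF i]
    show "i \<in> bell_index n h"
      unfolding bell_index_def supp mem_Collect_eq
      using sums[OF s, of "\<lambda>j. j"] sums[OF s, of "\<lambda>j. 1"] i s by simp
  qed
qed

lemma finite_bell_index: "finite (bell_index n h)"
proof (rule finite_subset)
  show "bell_index n h \<subseteq> {i. \<forall>j. (j \<in> {1..n - h + 1} \<longrightarrow> i j \<in> {0..h}) \<and> (j \<notin> {1..n - h + 1} \<longrightarrow> i j = 0)}"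
  proof safe
    fix i j assume i: "i \<in> bell_index n h" and "j \<in> {1..n - h + 1}"
    then have "i j \<le> (\<Sum>j=1..n - h + 1. i j)"
      by (intro member_le_sum) auto
    with i show "i j \<in> {0..h}"
      by (simp add: bell_index_def)
  qed (auto simp: bell_index_def)
  show "finite \<dots>"
    by (rule finite_set_of_finite_funs) auto
qed

unbundle no vec_syntax and fps_syntax

lemma one_minus_pow_neg_x_nth_0 [simp]: "one_minus_pow_neg_x k $ 0 = 1"
  by (simp add: one_minus_pow_neg_x_def binom_poly_def fps_compose_nth)

lemma one_minus_pow_neg_x_nth_less:
  assumes "0 < m" "m < k"
  shows "one_minus_pow_neg_x k $ m = 0"
  unfolding one_minus_pow_neg_x_def fps_compose_nth
proof (rule sum.neutral, intro ballI)
  fix i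
  have "m \<noteq> k * i"
    using assms by (cases i) auto
  then show "Abs_fps (\<lambda>i. (-1) ^ i * binom_poly (- [:0, 1:]) i) $ i * ((fps_X ^ k) ^ i $ m) = (0 :: rat poly)"
    by (simp add: power_mult[symmetric] fps_X_power_nth)
qed

lemma has_prod_one_minus_pow_neg_x:
  "(\<lambda>k. one_minus_pow_neg_x (Suc k)) has_prod
     Abs_fps (\<lambda>m. (\<Prod>k\<le>m. one_minus_pow_neg_x (Suc k)) $ m)"
proof -
  define P where "P = (\<lambda>n. \<Prod>k\<le>n. one_minus_pow_neg_x (Suc k))"
  have step: "P (Suc n) $ m = P n $ m" if "m \<le> n" for n m
  proof -
    have "P (Suc n) $ m = (\<Sum>i=0..m. P n $ i * one_minus_pow_neg_x (Suc (Suc n)) $ (m - i))"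
      by (simp add: P_def fps_mult_nth)
    also have "\<dots> = (\<Sum>i=0..m. if i = m then P n $ m else 0)"
      using that by (intro sum.cong) (auto simp: one_minus_pow_neg_x_nth_less)
    finally show ?thesis by simp
  qed
  have stable: "P n $ m = P m $ m" if "m \<le> n" for n m
    using that by (induction n rule: dec_induct) (auto simp: step)
  have "P \<longlonglongrightarrow> Abs_fps (\<lambda>m. P m $ m)"
    unfolding tendsto_fps_iff eventually_sequentially
  proof (intro allI exI impI)
    fix m n :: nat assume "m \<le> n"
    from stable[OF this] show "P n $ m = Abs_fps (\<lambda>m. P m $ m) $ m"
      by simp
  qed
  moreover have "Abs_fps (\<lambda>m. P m $ m) $ 0 = 1"
    by (simp add: P_def)
  then have "Abs_fps (\<lambda>m. P m $ m) \<noteq> 0"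
    by (metis fps_zero_nth zero_neq_one)
  ultimately show ?thesis
    by (simp add: has_prod_def raw_has_prod_def P_def)
qed

unbundle vec_syntax and no fps_syntax

end

theory Submission
  imports Defs
begin

text \<open>
  Both sides of (3) have constant term \<open>1\<close> and satisfy \<open>t F' = x (\<Sum>\<^sub>m \<sigma>(m) t\<^sup>m) F\<close>, which determines
  a power series over a domain of characteristic zero from its constant term. For the product this
  comes from the factors: \<open>(1 - t\<^sup>k)\<^sup>-\<^sup>x\<close> has logarithmic derivative \<open>x k t\<^sup>k\<^sup>-\<^sup>1 / (1 - t\<^sup>k)\<close>, and
  \<open>\<Sum>\<^sub>k k t\<^sup>k / (1 - t\<^sup>k)\<close> is the generating function of \<open>\<sigma>\<close>. The Bell polynomial formulas are the
  coefficients of the exponential, computed with the multinomial theorem.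
\<close>

unbundle no vec_syntax and fps_syntax

subsection \<open>Bell polynomials as coefficients of powers\<close>

text \<open>Vanishing outside \<open>A\<close> makes each family a unique function; a general index
  set \<open>A\<close> permits induction by \<open>insert\<close>.\<close>

definition exponents :: "'b set \<Rightarrow> nat \<Rightarrow> ('b \<Rightarrow> nat) set" where
  "exponents A h = {i. (\<forall>j. j \<notin> A \<longrightarrow> i j = 0) \<and> sum i A = h}"

lemma finite_exponents:
  assumes "finite A"
  shows "finite (exponents A h)"
proof (rule finite_subset)
  show "exponents A h \<subseteq> {i. \<forall>j. (j \<in> A \<longrightarrow> i j \<in> {0..h}) \<and> (j \<notin> A \<longrightarrow> i j = 0)}"
    using assms by (auto simp: exponents_def intro: member_le_sum)
  show "finite \<dots>"
    using assms by (intro finite_set_of_finite_funs) auto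
qed

text \<open>Families on the larger set are sorted by their value \<open>k\<close> at the new index
  \<open>a\<close>; resetting that value to 0 leaves a family on \<open>A\<close> of total
  \<open>h - k\<close>.\<close>

lemma sum_exponents_insert:
  assumes "finite A" "a \<notin> A"
  shows "(\<Sum>i\<in>exponents (insert a A) h. f i) = (\<Sum>k\<le>h. \<Sum>i\<in>exponents A (h - k). f (i(a := k)))"
proof -
  have upd: "sum (i(a := k)) A = sum i A" for i :: "'a \<Rightarrow> nat" and k
    using assms by (intro sum.cong) auto
  have "(\<Sum>k\<le>h. \<Sum>i\<in>exponents A (h - k). f (i(a := k))) =
      (\<Sum>(k, i)\<in>(SIGMA k:{..h}. exponents A (h - k)). f (i(a := k)))"
    using assms by (subst sum.Sigma) (auto simp: finite_exponents)
  also have "\<dots> = (\<Sum>i\<in>exponents (insert a A) h. f i)"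
    by (rule sum.reindex_bij_witness[where i = "\<lambda>i. (i a, i(a := 0))" and j = "\<lambda>(k, i). i(a := k)"])
      (use assms in \<open>auto simp: exponents_def upd simp del: fun_upd_apply, auto\<close>)
  finally show ?thesis by simp
qed

text \<open>Induction on \<open>A\<close>: the binomial theorem splits off \<open>u a\<close>, and
  the induction hypothesis expands the remaining power.\<close>

lemma fps_multinomial:
  fixes u :: "'b \<Rightarrow> 'a::field_char_0 fps"
  assumes "finite A"
  shows "(\<Sum>j\<in>A. u j) ^ h =
    (\<Sum>i\<in>exponents A h. fps_const (fact h / (\<Prod>j\<in>A. fact (i j))) * (\<Prod>j\<in>A. u j ^ i j))"
  using assms
proof (induction A arbitrary: h)
  case empty
  have "exponents ({} :: 'b set) h = (if h = 0 then {\<lambda>_. 0} else {})"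
    by (auto simp: exponents_def)
  then show ?case by (cases "h = 0") simp_all
next
  case (insert a A)
  have "(\<Sum>j\<in>insert a A. u j) ^ h = (\<Sum>k\<le>h. of_nat (h choose k) * u a ^ k * (\<Sum>j\<in>A. u j) ^ (h - k))"
    using insert by (simp add: binomial_ring)
  also have "\<dots> = (\<Sum>k\<le>h. \<Sum>i\<in>exponents A (h - k).
     fps_const (fact h / (\<Prod>j\<in>insert a A. fact ((i(a := k)) j))) * (\<Prod>j\<in>insert a A. u j ^ (i(a := k)) j))"
  proof (intro sum.cong refl)
    fix k assume k: "k \<in> {..h}"
    have *: "(\<Prod>j\<in>insert a A. g j ((i(a := k)) j)) = g a k * (\<Prod>j\<in>A. g j (i j))"
      for g :: "'b \<Rightarrow> nat \<Rightarrow> 'c::comm_monoid_mult" and i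
      using insert.hyps by (subst prod.insert) (auto intro!: arg_cong2[where f = "(*)"] prod.cong)
    have choose: "of_nat (h choose k) = fps_const (fact h / (fact k * fact (h - k)) :: 'a)"
      using k by (subst fps_of_nat[symmetric]) (simp add: binomial_fact)
    \<comment> \<open>The \<open>(h - k)!\<close> in the binomial coefficient cancels the numerator
      from the induction hypothesis.\<close>
    have coeff: "fps_const (fact h / (fact k * c)) =
        fps_const (fact h / (fact k * fact (h - k))) * fps_const (fact (h - k) / c)" for c :: 'a
      by simp
    show "of_nat (h choose k) * u a ^ k * (\<Sum>j\<in>A. u j) ^ (h - k) = (\<Sum>i\<in>exponents A (h - k).
     fps_const (fact h / (\<Prod>j\<in>insert a A. fact ((i(a := k)) j))) * (\<Prod>j\<in>insert a A. u j ^ (i(a := k)) j))"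
      unfolding *[of "\<lambda>_. fact"] *[of "\<lambda>j. (^) (u j)"] insert.IH sum_distrib_left choose
      by (intro sum.cong refl, subst coeff) (simp only: mult_ac)
  qed
  also have "\<dots> = (\<Sum>i\<in>exponents (insert a A) h.
      fps_const (fact h / (\<Prod>j\<in>insert a A. fact (i j))) * (\<Prod>j\<in>insert a A. u j ^ i j))"
    using insert.hyps by (subst sum_exponents_insert) auto
  finally show ?case .
qed

text \<open>Trades the range \<open>{1..n - h + 1}\<close>, which depends on \<open>h\<close>, for
  \<open>{1..n}\<close>, as the multinomial expansion requires. The support form
  \<open>bell_index_eq\<close> mentions neither range.\<close>

lemma bell_index_eq_exponents:
  assumes "1 \<le> h" "h \<le> n"
  shows "bell_index n h = {i \<in> exponents {1..n} h. (\<Sum>j=1..n. j * i j) = n}"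
proof -
  have supp: "{j. i j \<noteq> 0} \<subseteq> {1..n}" if "i \<in> bell_index n h" for i
  proof
    fix j assume "j \<in> {j. i j \<noteq> 0}"
    with that have "j \<in> {1..n - h + 1}"
      by (auto simp: bell_index_def simp del: atLeastAtMost_iff)
    with assms show "j \<in> {1..n}"
      by auto
  qed
  have *: "i \<in> bell_index n h \<longleftrightarrow> sum i {1..n} = h \<and> (\<Sum>j=1..n. j * i j) = n"
    if "{j. i j \<noteq> 0} \<subseteq> {1..n}" for i
  proof -
    have "(\<Sum>j | i j \<noteq> 0. j * i j) = (\<Sum>j=1..n. j * i j)"
      using that by (intro sum.mono_neutral_left) auto
    moreover have "(\<Sum>j | i j \<noteq> 0. i j) = (\<Sum>j=1..n. i j)"
      using that by (intro sum.mono_neutral_left) auto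
    moreover have "finite {j. i j \<noteq> 0}"
      using that by (rule finite_subset) simp
    moreover have "i 0 = 0"
      using that by (cases "i 0 = 0") auto
    ultimately show ?thesis
      unfolding bell_index_eq by auto
  qed
  have exps: "(\<forall>j. j \<notin> {1..n} \<longrightarrow> i j = 0) \<longleftrightarrow> {j. i j \<noteq> 0} \<subseteq> {1..n}" for i :: "nat \<Rightarrow> nat"
    by (auto simp del: atLeastAtMost_iff)
  show ?thesis
    unfolding exponents_def exps
  proof (rule set_eqI)
    fix i
    show "i \<in> bell_index n h \<longleftrightarrow>
        i \<in> {i \<in> {i. {j. i j \<noteq> 0} \<subseteq> {1..n} \<and> sum i {1..n} = h}. (\<Sum>j=1..n. j * i j) = n}"
      using supp[of i] *[of i] by (cases "{j. i j \<noteq> 0} \<subseteq> {1..n}") (simp_all, auto)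
  qed
qed

lemma fps_cutoff_power_nth:
  fixes f :: "'a::comm_semiring_1 fps"
  assumes "k < n"
  shows "(fps_cutoff n f ^ h) $ k = (f ^ h) $ k"
  using assms
proof (induction h arbitrary: k)
  case (Suc h)
  then show ?case
    by (auto simp: fps_mult_nth intro!: sum.cong)
qed simp

text \<open>Coefficient \<open>n\<close> of \<open>f ^ h\<close> sees only the terms of
  \<open>f\<close> up to degree \<open>n\<close>, so \<open>f\<close> becomes a finite sum of
  monomials. In its multinomial expansion the family \<open>i\<close> has degree
  \<open>\<Sum>j. j * i j\<close>, and asking for degree \<open>n\<close> selects
  \<open>bell_index n h\<close>.\<close>

lemma bell_ord_eq_power_nth:
  fixes f :: "'a::field_char_0 fps"
  assumes "f $ 0 = 0" "1 \<le> h" "h \<le> n"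
  shows "bell_ord n h (fps_nth f) = (f ^ h) $ n"
proof -
  define g where "g = (\<lambda>j. fps_const (f $ j) * fps_X ^ j)"
  have cut: "fps_cutoff (Suc n) f = sum g {1..n}"
  proof (rule fps_ext)
    fix m
    have "sum g {1..n} $ m = (\<Sum>j=1..n. if j = m then f $ m else 0)"
      unfolding fps_sum_nth g_def by (intro sum.cong) auto
    then show "fps_cutoff (Suc n) f $ m = sum g {1..n} $ m"
      using assms(1) by (cases "m = 0") auto
  qed
  have prod_X: "(\<Prod>j=1..n. g j ^ i j) = fps_const (\<Prod>j=1..n. (f $ j) ^ i j) * fps_X ^ (\<Sum>j=1..n. j * i j)" for i
  proof -
    have "(\<Prod>j\<in>A. g j ^ i j) = fps_const (\<Prod>j\<in>A. (f $ j) ^ i j) * fps_X ^ (\<Sum>j\<in>A. j * i j)" for A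
      by (induction A rule: infinite_finite_induct)
        (simp_all add: g_def power_mult_distrib power_add power_mult
          flip: fps_const_mult)
    then show ?thesis .
  qed
  \<comment> \<open>Beyond \<open>n - h + 1\<close> the exponents are 0, so the additional factors
    are 1.\<close>
  have restrict: "(\<Prod>j=1..n - h + 1. (f $ j) ^ i j / fact (i j)) = (\<Prod>j=1..n. (f $ j) ^ i j / fact (i j))"
    if "i \<in> bell_index n h" for i
    using that assms(2,3) by (intro prod.mono_neutral_left) (auto simp: bell_index_def)
  have "(f ^ h) $ n = (sum g {1..n} ^ h) $ n"
    unfolding cut[symmetric] by (simp add: fps_cutoff_power_nth)
  also have "\<dots> = (\<Sum>i\<in>exponents {1..n} h. if (\<Sum>j=1..n. j * i j) = n then
      fact h * (\<Prod>j=1..n. (f $ j) ^ i j / fact (i j)) else 0)"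
    unfolding fps_multinomial[OF finite_atLeastAtMost] prod_X fps_sum_nth
    by (intro sum.cong) (auto simp: prod_dividef)
  also have "\<dots> = (\<Sum>i\<in>bell_index n h. fact h * (\<Prod>j=1..n. (f $ j) ^ i j / fact (i j)))"
    unfolding bell_index_eq_exponents[OF assms(2,3)]
    by (subst sum.inter_filter) (auto simp: finite_exponents)
  also have "\<dots> = bell_ord n h (fps_nth f)"
    unfolding bell_ord_def sum_distrib_left by (intro sum.cong refl) (simp only: restrict)
  finally show ?thesis by simp
qed

text \<open>Since (j - 1)!/j! = 1/j, the two sums have the same terms up to the prefactors n! and
  h!.\<close>

lemma bell_exp_eq_bell_ord:
  "bell_exp n h (\<lambda>j. fact (j - 1) * x j) = fact n / fact h * bell_ord n h (\<lambda>j. x j / of_nat j)"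
proof -
  have ratio: "(\<Prod>j=1..n - h + 1. (fact (j - 1) * x j / fact j) ^ i j) =
      (\<Prod>j=1..n - h + 1. (x j / of_nat j) ^ i j)" for i
    by (intro prod.cong) (auto simp: fact_reduce)
  have cancel: "fact n / q * p = fact n / fact h * (fact h * (p / q))" for p q :: 'a
    by simp
  show ?thesis
    unfolding bell_exp_def bell_ord_def sum_distrib_left prod_dividef ratio
    by (intro sum.cong refl) (rule cancel)
qed

subsection \<open>Power series with a given logarithmic derivative\<close>

text \<open>As \<open>D $ 0 = 0\<close>, comparing coefficients gives the recursion n F_n = D_1
  F_(n-1) + ... + D_n F_0, and n > 0 can be cancelled.\<close>

lemma fps_log_deriv_unique:
  fixes F G D :: "'a::{idom,ring_char_0} fps"
  assumes "fps_X * fps_deriv F = D * F" "fps_X * fps_deriv G = D * G" "D $ 0 = 0" "F $ 0 = G $ 0"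
  shows "F = G"
proof (rule fps_ext)
  fix n
  show "F $ n = G $ n"
  proof (induction n rule: less_induct)
    case (less n)
    show ?case
    proof (cases n)
      case (Suc m)
      have *: "of_nat n * H $ n = (\<Sum>i=1..n. D $ i * H $ (n - i))"
        if "fps_X * fps_deriv H = D * H" for H
      proof -
        have "of_nat n * H $ n = (fps_X * fps_deriv H) $ n"
          using Suc by simp
        also have "\<dots> = (\<Sum>i=0..n. D $ i * H $ (n - i))"
          unfolding that fps_mult_nth ..
        also have "\<dots> = (\<Sum>i=1..n. D $ i * H $ (n - i))"
          using assms(3) by (simp add: sum.atLeast_Suc_atMost)
        finally show ?thesis .
      qed
      have "of_nat n * F $ n = of_nat n * G $ n"
        unfolding *[OF assms(1)] *[OF assms(2)]
        by (intro sum.cong refl) (use less Suc in auto)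
      then show ?thesis
        using Suc by (simp del: of_nat_Suc)
    qed (use assms in simp)
  qed
qed

lemma fps_deriv_exp_fps:
  assumes "G $ 0 = 0"
  shows "fps_deriv (exp_fps G) = fps_deriv G * exp_fps G"
proof -
  have "fps_deriv (Abs_fps (\<lambda>i. [:1 / fact i:])) = Abs_fps (\<lambda>i. [:1 / fact i:] :: rat poly)"
    by (rule fps_ext) (simp add: of_nat_poly divide_simps del: of_nat_Suc)
  then show ?thesis
    using assms by (simp add: exp_fps_def fps_compose_deriv mult.commute)
qed

subsection \<open>The Euler product\<close>

text \<open>The Lambert term k t^k / (1 - t^k) for k > 0, given by coefficients so that no division
  occurs.\<close>

definition divisor_fps :: "nat \<Rightarrow> rat poly fps" where
  "divisor_fps k = Abs_fps (\<lambda>n. if n > 0 \<and> k dvd n then of_nat k else 0)"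

lemma divisor_fps_mult:
  assumes "k > 0"
  shows "(1 - fps_X ^ k) * divisor_fps k = of_nat k * fps_X ^ k"
  using assms
  by (intro fps_ext) (auto simp: divisor_fps_def left_diff_distrib fps_X_power_mult_nth
     dvd_minus_self)

text \<open>The binomial series g = (1 - t)^(-x) satisfies (1 - t) g' = x g. Substituting t^k and
  applying the chain rule gives the claim multiplied by 1 - t^k, which is cancelled at the
  end.\<close>

lemma log_deriv_one_minus_pow_neg_x:
  assumes "k > 0"
  shows "fps_X * fps_deriv (one_minus_pow_neg_x k) =
    fps_const [:0, 1:] * divisor_fps k * one_minus_pow_neg_x k"
proof -
  define g :: "rat poly fps" where "g = Abs_fps (\<lambda>i. (-1) ^ i * binom_poly (- [:0, 1:]) i)"
  have f: "one_minus_pow_neg_x k = g oo fps_X ^ k"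
    by (simp add: one_minus_pow_neg_x_def g_def)
  have X0: "(fps_X ^ k :: rat poly fps) $ 0 = 0"
    using assms by simp
  \<comment> \<open>The new factor -x - i of the falling factorial, with the new sign, is x +
    i.\<close>
  have rec: "of_nat (Suc i) * g $ Suc i = ([:0, 1:] + of_nat i) * g $ i" for i
  proof -
    have "of_nat (Suc i) * g $ Suc i = smult (of_nat (Suc i) / fact (Suc i))
        ((-1) ^ Suc i * (\<Prod>j<Suc i. - [:0, 1:] - of_nat j))"
      unfolding g_def fps_nth_Abs_fps binom_poly_def of_nat_poly by (simp del: of_nat_Suc fact_Suc)
    also have "of_nat (Suc i) / fact (Suc i) = (1 / fact i :: rat)"
      by (simp add: divide_simps del: of_nat_Suc)
    finally show ?thesis
      by (simp add: g_def binom_poly_def algebra_simps)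
  qed
  have "(1 - fps_X) * fps_deriv g = fps_const [:0, 1:] * g"
  proof (rule fps_ext)
    fix i
    show "((1 - fps_X) * fps_deriv g) $ i = (fps_const [:0, 1:] * g) $ i"
      using rec[of i] by (cases i) (auto simp: algebra_simps)
  qed
  then have "((1 - fps_X) * fps_deriv g) oo fps_X ^ k = (fps_const [:0, 1:] * g) oo fps_X ^ k"
    by simp
  then have ode: "(1 - fps_X ^ k) * (fps_deriv g oo fps_X ^ k) = fps_const [:0, 1:] * (g oo fps_X ^ k)"
    using X0 by (simp add: fps_compose_mult_distrib fps_compose_sub_distrib)
  have Xk: "fps_X * fps_deriv (fps_X ^ k) = (of_nat k * fps_X ^ k :: rat poly fps)"
    using assms power_Suc[of "fps_X :: rat poly fps" "k - 1"] by (simp add: fps_deriv_power' mult_ac)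
  have "(1 - fps_X ^ k) * (fps_X * fps_deriv (one_minus_pow_neg_x k)) =
      ((1 - fps_X ^ k) * (fps_deriv g oo fps_X ^ k)) * (fps_X * fps_deriv (fps_X ^ k))"
    unfolding f fps_compose_deriv[OF X0] by (simp only: mult_ac)
  also have "\<dots> = (1 - fps_X ^ k) * (fps_const [:0, 1:] * divisor_fps k * one_minus_pow_neg_x k)"
    unfolding ode Xk divisor_fps_mult[OF assms, symmetric] f by (simp only: mult_ac)
  finally show ?thesis
  proof (rule mult_left_cancel[THEN iffD1, rotated])
    have "(1 - fps_X ^ k :: rat poly fps) $ 0 \<noteq> 0"
      using assms by simp
    then show "(1 - fps_X ^ k :: rat poly fps) \<noteq> 0"
      by (metis fps_zero_nth)
  qed
qed

text \<open>By the product rule, logarithmic derivatives add.\<close>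

lemma log_deriv_prod:
  fixes f D :: "'b \<Rightarrow> 'a::comm_semiring_1 fps"
  assumes "finite A" "\<And>k. k \<in> A \<Longrightarrow> fps_X * fps_deriv (f k) = D k * f k"
  shows "fps_X * fps_deriv (prod f A) = sum D A * prod f A"
  using assms
proof (induction A)
  case (insert a A)
  have "fps_X * fps_deriv (prod f (insert a A)) =
      f a * (fps_X * fps_deriv (prod f A)) + (fps_X * fps_deriv (f a)) * prod f A"
    unfolding prod.insert[OF insert.hyps] by (simp only: fps_deriv_mult distrib_left mult_ac)
  also have "\<dots> = f a * (sum D A * prod f A) + (D a * f a) * prod f A"
    using insert by simp
  finally show ?case
    using insert by (simp add: algebra_simps)
qed simp

definition divisor_sum_fps :: "rat poly fps" where
  "divisor_sum_fps = Abs_fps (\<lambda>n. if n = 0 then 0 else of_nat (divisor_sum n))"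

text \<open>Divisors of a positive \<open>n\<close> are at most \<open>n\<close>, so the terms up to
  \<open>Suc N\<close> already account for all of them.\<close>

lemma sum_divisor_fps_nth:
  assumes "n \<le> Suc N"
  shows "(\<Sum>k\<le>N. divisor_fps (Suc k)) $ n = divisor_sum_fps $ n"
proof (cases "n = 0")
  case False
  have "(\<Sum>k\<le>N. divisor_fps (Suc k)) $ n = (\<Sum>k\<in>Suc ` {..N}. if k dvd n then of_nat k else 0)"
    using False by (simp add: fps_sum_nth divisor_fps_def sum.reindex)
  also have "\<dots> = (\<Sum>k\<in>{k \<in> Suc ` {..N}. k dvd n}. of_nat k)"
    by (subst sum.inter_filter) auto
  also have "{k \<in> Suc ` {..N}. k dvd n} = {k. k dvd n}"
  proof safe
    fix k assume "k dvd n"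
    with False assms have "k \<noteq> 0" "k \<le> Suc N"
      by (auto dest: dvd_imp_le)
    then show "k \<in> Suc ` {..N}"
      by (cases k) auto
  qed
  finally show ?thesis
    using False by (simp add: divisor_sum_fps_def divisor_sum_def)
qed (simp add: fps_sum_nth divisor_fps_def divisor_sum_fps_def)

text \<open>Each coefficient of the identity involves finitely many coefficients of
  \<open>F\<close>, which agree with those of a late partial product; there
  \<open>log_deriv_prod\<close> applies.\<close>

lemma log_deriv_prodinf:
  defines "F \<equiv> (\<Prod>k. one_minus_pow_neg_x (Suc k))"
  shows "fps_X * fps_deriv F = fps_const [:0, 1:] * divisor_sum_fps * F" and "F $ 0 = 1"
proof -
  define P where "P = (\<lambda>N. \<Prod>k\<le>N. one_minus_pow_neg_x (Suc k))"
  have F_eq: "F = Abs_fps (\<lambda>m. (\<Prod>k\<le>m. one_minus_pow_neg_x (Suc k)) $ m)"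
    unfolding F_def by (rule has_prod_unique[OF has_prod_one_minus_pow_neg_x, symmetric])
  have "P \<longlonglongrightarrow> F"
  proof -
    \<comment> \<open>\<open>has_prod\<close> also allows the value 0 caused by a vanishing factor;
      this excludes that case, leaving plain convergence of \<open>P\<close>.\<close>
    have "one_minus_pow_neg_x (Suc k) \<noteq> 0" for k
      by (metis fps_zero_nth one_minus_pow_neg_x_nth_0 zero_neq_one)
    then show ?thesis
      using has_prod_one_minus_pow_neg_x
      unfolding P_def F_eq
      by (auto simp: has_prod_def raw_has_prod_def)
  qed
  then have ev: "\<forall>\<^sub>F N in sequentially. P N $ m = F $ m" for m
    by (simp add: tendsto_fps_iff)
  show "F $ 0 = 1"
    by (simp add: F_eq)
  show "fps_X * fps_deriv F = fps_const [:0, 1:] * divisor_sum_fps * F"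
  proof (rule fps_ext)
    fix n
    have "\<forall>\<^sub>F N in sequentially. n \<le> N \<and> (\<forall>m\<in>{..n}. P N $ m = F $ m)"
      using ev by (intro eventually_conj eventually_ge_at_top eventually_ball_finite) auto
    then obtain N where N: "n \<le> N" "\<And>m. m \<le> n \<Longrightarrow> P N $ m = F $ m"
      by (auto dest: eventually_happens)
    \<comment> \<open>Coefficient \<open>n\<close> of t F' is n F_n, so agreement at
      \<open>n\<close> suffices here.\<close>
    have "(fps_X * fps_deriv F) $ n = (fps_X * fps_deriv (P N)) $ n"
      using N(2)[of n] by (cases n) auto
    also have "fps_X * fps_deriv (P N) =
        (\<Sum>k\<le>N. fps_const [:0, 1:] * divisor_fps (Suc k)) * P N"
      unfolding P_def by (rule log_deriv_prod) (simp_all add: log_deriv_one_minus_pow_neg_x)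
    also have "\<dots> $ n = (fps_const [:0, 1:] * divisor_sum_fps * F) $ n"
      unfolding sum_distrib_left[symmetric] fps_mult_nth[of _ "P N"] fps_mult_nth[of _ F]
        fps_mult_left_const_nth
      by (intro sum.cong refl) (use N in \<open>simp add: sum_divisor_fps_nth\<close>)
    finally show "(fps_X * fps_deriv F) $ n = (fps_const [:0, 1:] * divisor_sum_fps * F) $ n" .
  qed
qed

section \<open>Coefficients of the exponential as polynomials in x, and the three formulas\<close>

lemma fps_const_poly_power_nth:
  "((fps_const [:0, 1:] * Abs_fps (\<lambda>k. [:a k:])) ^ h) $ n = monom ((Abs_fps a ^ h) $ n) h"
  for a :: "nat \<Rightarrow> 'a::comm_semiring_1"
proof -
  \<comment> \<open>Constant polynomials are closed under products and sums, so the only power of x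
    in the result is the x^h pulled out of the base.\<close>
  have "(Abs_fps (\<lambda>k. [:a k:]) ^ h) $ n = [:(Abs_fps a ^ h) $ n:]"
  proof (induction h arbitrary: n)
    case (Suc h)
    have "(\<Sum>i\<in>A. [:f i:]) = [:\<Sum>i\<in>A. f i:]" for f :: "nat \<Rightarrow> 'a" and A
      by (induction A rule: infinite_finite_induct) auto
    then show ?case
      by (simp add: fps_mult_nth Suc mult.commute)
  qed (simp add: one_pCons)
  then show ?thesis
    by (simp add: power_mult_distrib monom_altdef)
qed

theorem proposition6:
  fixes \<phi> :: "nat \<Rightarrow> rat poly"
  assumes "Abs_fps (\<lambda>h. \<phi> (h + 1)) = (\<Prod>k. one_minus_pow_neg_x (k + 1))"
  shows "(\<forall>n\<ge>1. \<phi> (n + 1) =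
            smult (1 / fact n)
              (\<Sum>h=1..n. monom (bell_exp n h (\<lambda>j. fact (j - 1) * of_nat (divisor_sum j))) h)) \<and>
         (\<forall>n\<ge>1. \<phi> (n + 1) =
            (\<Sum>h=1..n. monom (1 / fact h * bell_ord n h (\<lambda>j. of_nat (divisor_sum j) / of_nat j)) h)) \<and>
         Abs_fps (\<lambda>h. \<phi> (h + 1)) =
            exp_fps (fps_const [:0, 1:] *
              Abs_fps (\<lambda>k. if k = 0 then 0 else [:of_nat (divisor_sum k) / of_nat k:]))"
proof -
  \<comment> \<open>At \<open>k = 0\<close> the convention \<open>x / 0 = 0\<close> gives the required constant term.\<close>
  define a :: "nat \<Rightarrow> rat" where "a = (\<lambda>k. of_nat (divisor_sum k) / of_nat k)"
  define G where "G = fps_const [:0, 1:] * Abs_fps (\<lambda>k. [:a k:])"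
  have G: "fps_const [:0, 1:] * Abs_fps (\<lambda>k. if k = 0 then 0 else [:of_nat (divisor_sum k) / of_nat k:]) = G"
    unfolding G_def a_def by (intro arg_cong2[where f = "(*)"] refl fps_ext) auto
  have G0: "G $ 0 = 0"
    by (simp add: G_def a_def)
  \<comment> \<open>Differentiation multiplies the coefficient of t^k by k, cancelling the
    denominator in \<sigma>(k)/k.\<close>
  have "fps_X * fps_deriv G = fps_const [:0, 1:] * divisor_sum_fps"
    by (intro fps_ext) (auto simp: G_def a_def divisor_sum_fps_def of_nat_poly)
  then have "fps_X * fps_deriv (exp_fps G) = fps_const [:0, 1:] * divisor_sum_fps * exp_fps G"
    by (simp add: fps_deriv_exp_fps[OF G0] mult.assoc[symmetric])
  then have "(\<Prod>k. one_minus_pow_neg_x (Suc k)) = exp_fps G"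
    by (rule fps_log_deriv_unique[OF log_deriv_prodinf(1)])
      (simp_all add: log_deriv_prodinf(2) divisor_sum_fps_def exp_fps_def one_pCons)
  then have main: "Abs_fps (\<lambda>h. \<phi> (h + 1)) = exp_fps G"
    using assms by simp
  have ord: "\<phi> (n + 1) = (\<Sum>h=1..n. monom (1 / fact h * bell_ord n h a) h)" if "n \<ge> 1" for n
  proof -
    have "\<phi> (n + 1) = exp_fps G $ n"
      using main by (metis fps_nth_Abs_fps)
    also have "\<dots> = (\<Sum>h=0..n. [:1 / fact h:] * monom ((Abs_fps a ^ h) $ n) h)"
      unfolding exp_fps_def fps_compose_nth G_def fps_const_poly_power_nth by simp
    \<comment> \<open>The term \<open>h = 0\<close> is a coefficient of the series 1 in positive
      degree, hence 0.\<close>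
    also have "\<dots> = (\<Sum>h=1..n. [:1 / fact h:] * monom ((Abs_fps a ^ h) $ n) h)"
      using that by (simp add: sum.atLeast_Suc_atMost)
    also have "\<dots> = (\<Sum>h=1..n. monom (1 / fact h * bell_ord n h a) h)"
    proof (intro sum.cong refl)
      fix h assume "h \<in> {1..n}"
      then have "(Abs_fps a ^ h) $ n = bell_ord n h (fps_nth (Abs_fps a))"
        by (intro bell_ord_eq_power_nth[symmetric]) (auto simp: a_def)
      then show "[:1 / fact h:] * monom ((Abs_fps a ^ h) $ n) h = monom (1 / fact h * bell_ord n h a) h"
        by (simp add: Abs_fps_inverse smult_monom)
    qed
    finally show ?thesis .
  qed
  have exp: "bell_exp n h (\<lambda>j. fact (j - 1) * of_nat (divisor_sum j)) = fact n / fact h * bell_ord n h a" for n h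
    unfolding a_def by (rule bell_exp_eq_bell_ord)
  \<comment> \<open>The n! relating the two Bell polynomials cancels the prefactor 1/n!, so (1)
    reduces to (2).\<close>
  have "smult (1 / fact n) (\<Sum>h=1..n. monom (fact n / fact h * bell_ord n h a) h) =
      (\<Sum>h=1..n. monom (1 / fact h * bell_ord n h a) h)" for n
    using sum_distrib_left[of "[:1 / fact n:]" "\<lambda>h. monom (fact n / fact h * bell_ord n h a) h" "{1..n}"]
    by (simp add: smult_monom)
  with ord have "\<forall>n\<ge>1. \<phi> (n + 1) = smult (1 / fact n)
      (\<Sum>h=1..n. monom (bell_exp n h (\<lambda>j. fact (j - 1) * of_nat (divisor_sum j))) h)"
    unfolding exp by simp
  moreover have "\<forall>n\<ge>1. \<phi> (n + 1) =
      (\<Sum>h=1..n. monom (1 / fact h * bell_ord n h (\<lambda>j. of_nat (divisor_sum j) / of_nat j)) h)"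
    using ord unfolding a_def by blast
  ultimately show ?thesis
    unfolding G using main by blast
qed

unbundle vec_syntax and no fps_syntax

end
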